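(* Let $X$ be a topological module over a topological ring $R$, and let $B_n(X\times X)$ be the set of all $n$-bounded bigroup homomorphisms $X\times X\to X$, with pointwise addition and pointwise multiplication by elements of $R$. Then addition and module multiplication in $B_n(X\times X)$ are continuous with respect to uniform convergence on some zero neighborhoods. That is, if $(\sigma_\alpha)$ and $(\gamma_\alpha)$ are nets in $B_n(X\times X)$ and $(r_\alpha)$ is a net in $R$, all indexed by the same directed set, such that $\sigma_\alpha\to\sigma\in B_n(X\times X)$ and $\gamma_\alpha\to\gamma\in B_n(X\times X)$ uniformly on some zero neighborhoods and $r_\alpha\to r$ in $R$, then $\sigma_\alpha+\gamma_\alpha\to\sigma+\gamma$ and $r_\alpha\sigma_\alpha\to r\sigma$ uniformly on some zero neighborhoods.
   Context: A topological module $X$ over a topological ring $R$ is an $R$-module with a topology making $X$ a topological additive group and making the multiplication $R\times X\to X$ (jointly) continuous. A zero neighborhood is a neighborhood of $0$. A set $B\subseteq X$ is bounded if for each zero neighborhood $W\subseteq X$ there is a zero neighborhood $V\subseteq R$ such that $VB\subseteq W$, where $VB=\{vb: v\in V, b\in B\}$. A bigroup homomorphism $\sigma:X\times X\to X$ is a map that is a homomorphism of additive groups in each variable separately. For $A,B\subseteq X$, $\sigma(A,B)=\{\sigma(a,b):a\in A,b\in B\}$. $\sigma$ is $n$-bounded if there exist zero neighborhoods $U,V\subseteq X$ such that $\sigma(U,V)$ is bounded in $X$. A net $(\sigma_\alpha)$ of bigroup homomorphisms converges to zero uniformly on some zero neighborhoods if there exist zero neighborhoods $U,V\subseteq X$ such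 that for each zero neighborhood $W\subseteq X$ there is an $\alpha_0$ with $\sigma_\alpha(U,V)\subseteq W$ for all $\alpha\ge\alpha_0$. It converges to $\sigma$ in this sense if $(\sigma_\alpha-\sigma)$ converges to zero in this sense. *)

theory Defs
  imports Complex_Main
begin

text \<open>
  The ring is neither assumed commutative nor unital, and no topology is assumed Hausdorff.
  The library locale \<open>module\<close> is not reused because it requires a commutative unital ring.
\<close>

locale topological_module =
  fixes scale :: "'r::{ring, topological_ab_group_add, topological_semigroup_mult}
    \<Rightarrow> 'x::topological_ab_group_add \<Rightarrow> 'x"
  assumes scale_right_distrib: "scale r (x + y) = scale r x + scale r y"
    and scale_left_distrib: "scale (r + s) x = scale r x + scale s x"
    and scale_scale: "scale r (scale s x) = scale (r * s) x"
    and continuous_scale: "continuous_on UNIV (\<lambda>(r, x). scale r x)"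

definition zero_nbhd :: "'a::{topological_space, zero} set \<Rightarrow> bool" where
  "zero_nbhd U \<longleftrightarrow> (\<exists>S. open S \<and> 0 \<in> S \<and> S \<subseteq> U)"

definition image2 :: "('a \<Rightarrow> 'b \<Rightarrow> 'c) \<Rightarrow> 'a set \<Rightarrow> 'b set \<Rightarrow> 'c set" where
  "image2 f A B = {f a b | a b. a \<in> A \<and> b \<in> B}"

definition module_bounded ::
  "('r::{topological_space, zero} \<Rightarrow> 'x::{topological_space, zero} \<Rightarrow> 'x) \<Rightarrow> 'x set \<Rightarrow> bool" where
  "module_bounded scale B \<longleftrightarrow>
     (\<forall>W. zero_nbhd W \<longrightarrow> (\<exists>V. zero_nbhd V \<and> image2 scale V B \<subseteq> W))"

definition bigroup_hom :: "('x::ab_group_add \<Rightarrow> 'x \<Rightarrow> 'x) \<Rightarrow> bool" where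
  "bigroup_hom \<sigma> \<longleftrightarrow>
     (\<forall>x x' y. \<sigma> (x + x') y = \<sigma> x y + \<sigma> x' y) \<and>
     (\<forall>x y y'. \<sigma> x (y + y') = \<sigma> x y + \<sigma> x y')"

definition n_bounded ::
  "('r::{topological_space, zero} \<Rightarrow> 'x::{topological_space, zero} \<Rightarrow> 'x)
    \<Rightarrow> ('x \<Rightarrow> 'x \<Rightarrow> 'x) \<Rightarrow> bool" where
  "n_bounded scale \<sigma> \<longleftrightarrow>
     (\<exists>U V. zero_nbhd U \<and> zero_nbhd V \<and> module_bounded scale (image2 \<sigma> U V))"

definition Bn ::
  "('r::{topological_space, zero} \<Rightarrow> 'x::topological_ab_group_add \<Rightarrow> 'x)
    \<Rightarrow> ('x \<Rightarrow> 'x \<Rightarrow> 'x) set" where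
  "Bn scale = {\<sigma>. bigroup_hom \<sigma> \<and> n_bounded scale \<sigma>}"

text \<open>
  A net is a function on a type \<open>'i\<close> of which only the values on a directed index set \<open>I\<close> matter.
  The order on \<open>I\<close> is a preorder; antisymmetry is not required.
\<close>

locale directed_index =
  fixes I :: "'i set" and le :: "'i \<Rightarrow> 'i \<Rightarrow> bool"
  assumes nonempty: "I \<noteq> {}"
    and refl: "a \<in> I \<Longrightarrow> le a a"
    and trans: "\<lbrakk>a \<in> I; b \<in> I; c \<in> I; le a b; le b c\<rbrakk> \<Longrightarrow> le a c"
    and directed: "\<lbrakk>a \<in> I; b \<in> I\<rbrakk> \<Longrightarrow> \<exists>c\<in>I. le a c \<and> le b c"

definition net_filter :: "'i set \<Rightarrow> ('i \<Rightarrow> 'i \<Rightarrow> bool) \<Rightarrow> 'i filter" where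
  "net_filter I le = (INF a\<in>I. principal {b \<in> I. le a b})"

lemma (in directed_index) eventually_net_filter:
  "eventually P (net_filter I le) \<longleftrightarrow> (\<exists>a\<in>I. \<forall>b\<in>I. le a b \<longrightarrow> P b)"
proof -
  have "\<exists>c\<in>I. principal {d \<in> I. le c d} \<le>
      inf (principal {d \<in> I. le a d}) (principal {d \<in> I. le b d})"
    if ab: "a \<in> I" "b \<in> I" for a b
  proof -
    obtain c where "c \<in> I" "le a c" "le b c"
      using directed ab by blast
    then have "{d \<in> I. le c d} \<subseteq> {d \<in> I. le a d} \<inter> {d \<in> I. le b d}"
      using trans ab by blast
    with \<open>c \<in> I\<close> show ?thesis by auto
  qed
  then show ?thesis
    unfolding net_filter_def using nonempty
    by (subst eventually_INF_base) (auto simp: eventually_principal)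
qed

definition converges_to_zero_unif ::
  "'i set \<Rightarrow> ('i \<Rightarrow> 'i \<Rightarrow> bool) \<Rightarrow> ('i \<Rightarrow> 'x::{topological_space, zero} \<Rightarrow> 'x \<Rightarrow> 'x) \<Rightarrow> bool" where
  "converges_to_zero_unif I le \<sigma> \<longleftrightarrow>
     (\<exists>U V. zero_nbhd U \<and> zero_nbhd V \<and>
        (\<forall>W. zero_nbhd W \<longrightarrow>
           (\<exists>a\<in>I. \<forall>b\<in>I. le a b \<longrightarrow> image2 (\<sigma> b) U V \<subseteq> W)))"

definition converges_unif ::
  "'i set \<Rightarrow> ('i \<Rightarrow> 'i \<Rightarrow> bool) \<Rightarrow> ('i \<Rightarrow> 'x::topological_ab_group_add \<Rightarrow> 'x \<Rightarrow> 'x)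
    \<Rightarrow> ('x \<Rightarrow> 'x \<Rightarrow> 'x) \<Rightarrow> bool" where
  "converges_unif I le \<sigma>s \<sigma> \<longleftrightarrow> converges_to_zero_unif I le (\<lambda>i x y. \<sigma>s i x y - \<sigma> x y)"

text \<open>The pointwise operations are well defined on \<^term>\<open>Bn scale\<close>.\<close>

lemma zero_nbhd_iff: "zero_nbhd U \<longleftrightarrow> eventually (\<lambda>x. x \<in> U) (nhds 0)"
  by (auto simp: zero_nbhd_def eventually_nhds)

lemma zero_nbhd_Int: "zero_nbhd U \<Longrightarrow> zero_nbhd V \<Longrightarrow> zero_nbhd (U \<inter> V)"
  by (auto simp: zero_nbhd_iff eventually_conj_iff)

lemma image2_image2_subset_iff:
  "image2 f A (image2 g B C) \<subseteq> W \<longleftrightarrow> (\<forall>a\<in>A. \<forall>b\<in>B. \<forall>c\<in>C. f a (g b c) \<in> W)"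
  unfolding image2_def by blast

context topological_module
begin

lemma Bn_add:
  assumes "\<sigma> \<in> Bn scale" "\<gamma> \<in> Bn scale"
  shows "(\<lambda>x y. \<sigma> x y + \<gamma> x y) \<in> Bn scale"
proof -
  from assms obtain U V U' V'
    where nb: "zero_nbhd U" "zero_nbhd V" "zero_nbhd U'" "zero_nbhd V'"
      and bd: "module_bounded scale (image2 \<sigma> U V)" "module_bounded scale (image2 \<gamma> U' V')"
    by (auto simp: Bn_def n_bounded_def)
  have "\<exists>N. zero_nbhd N \<and>
      image2 scale N (image2 (\<lambda>x y. \<sigma> x y + \<gamma> x y) (U \<inter> U') (V \<inter> V')) \<subseteq> W"
    if W: "zero_nbhd W" for W
  proof -
    have "filterlim (\<lambda>p. fst p + snd p) (nhds (0 + 0)) (nhds (0::'x) \<times>\<^sub>F nhds 0)"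
      by (rule tendsto_add_Pair)
    then have "eventually (\<lambda>p. fst p + snd p \<in> W) (nhds (0::'x) \<times>\<^sub>F nhds 0)"
      using W unfolding zero_nbhd_iff filterlim_iff by (auto dest: spec[of _ "\<lambda>x. x \<in> W"])
    then obtain P Q where PQ: "eventually P (nhds (0::'x))" "eventually Q (nhds (0::'x))"
        "\<And>x y. P x \<Longrightarrow> Q y \<Longrightarrow> x + y \<in> W"
      unfolding eventually_prod_filter by auto
    have zeroP: "zero_nbhd {x. P x}" and zeroQ: "zero_nbhd {x. Q x}"
      using PQ(1,2) by (simp_all add: zero_nbhd_iff)
    obtain N where N: "zero_nbhd N" "image2 scale N (image2 \<sigma> U V) \<subseteq> {x. P x}"
      using bd(1) zeroP unfolding module_bounded_def by blast
    obtain N' where N': "zero_nbhd N'" "image2 scale N' (image2 \<gamma> U' V') \<subseteq> {x. Q x}"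
      using bd(2) zeroQ unfolding module_bounded_def by blast
    have "scale n (\<sigma> x y + \<gamma> x y) \<in> W"
      if "n \<in> N \<inter> N'" "x \<in> U \<inter> U'" "y \<in> V \<inter> V'" for n x y
    proof -
      have "P (scale n (\<sigma> x y))" "Q (scale n (\<gamma> x y))"
        using N(2) N'(2) that unfolding image2_image2_subset_iff by auto
      then show ?thesis
        using PQ(3) by (simp add: scale_right_distrib)
    qed
    then have "image2 scale (N \<inter> N') (image2 (\<lambda>x y. \<sigma> x y + \<gamma> x y) (U \<inter> U') (V \<inter> V')) \<subseteq> W"
      unfolding image2_image2_subset_iff by simp
    with zero_nbhd_Int[OF N(1) N'(1)] show ?thesis by blast
  qed
  then have "n_bounded scale (\<lambda>x y. \<sigma> x y + \<gamma> x y)"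
    unfolding n_bounded_def module_bounded_def
    using zero_nbhd_Int[OF nb(1,3)] zero_nbhd_Int[OF nb(2,4)]
    by (intro exI[of _ "U \<inter> U'"] exI[of _ "V \<inter> V'"]) simp
  with assms show ?thesis
    by (simp add: Bn_def bigroup_hom_def algebra_simps)
qed

lemma Bn_scale:
  assumes "\<sigma> \<in> Bn scale"
  shows "(\<lambda>x y. scale r (\<sigma> x y)) \<in> Bn scale"
proof -
  from assms obtain U V
    where nb: "zero_nbhd U" "zero_nbhd V" and bd: "module_bounded scale (image2 \<sigma> U V)"
    by (auto simp: Bn_def n_bounded_def)
  have "\<exists>N. zero_nbhd N \<and> image2 scale N (image2 (\<lambda>x y. scale r (\<sigma> x y)) U V) \<subseteq> W"
    if W: "zero_nbhd W" for W
  proof -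
    obtain N where N: "zero_nbhd N" "image2 scale N (image2 \<sigma> U V) \<subseteq> W"
      using bd W unfolding module_bounded_def by blast
    have "((\<lambda>s. s * r) \<longlongrightarrow> 0 * r) (nhds 0)"
      by (rule tendsto_mult_right) (rule filterlim_ident)
    then have "zero_nbhd {s. s * r \<in> N}"
      using N(1) unfolding zero_nbhd_iff filterlim_iff by (auto dest: spec[of _ "\<lambda>x. x \<in> N"])
    moreover have "image2 scale {s. s * r \<in> N} (image2 (\<lambda>x y. scale r (\<sigma> x y)) U V) \<subseteq> W"
      using N(2) by (auto simp: image2_image2_subset_iff scale_scale)
    ultimately show ?thesis by blast
  qed
  then have "n_bounded scale (\<lambda>x y. scale r (\<sigma> x y))"
    unfolding n_bounded_def module_bounded_def
    using nb by (intro exI[of _ U] exI[of _ V]) simp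
  with assms show ?thesis
    by (simp add: Bn_def bigroup_hom_def scale_right_distrib)
qed

end

end

theory Submission
  imports Defs
begin

text \<open>
  Uniform convergence on \<open>U \<times> V\<close> is an ordinary limit along the product of the filter of
  the net with the principal filter of \<open>U \<times> V\<close>, and boundedness of \<open>\<sigma>(U, V)\<close> is the limit
  \<open>s \<sigma>(x, y) \<rightarrow> 0\<close> as \<open>s \<rightarrow> 0\<close> in \<open>R\<close>, uniformly in \<open>(x, y) \<in> U \<times> V\<close>. The lemmas
  \<open>converges_to_zero_unif_iff_tendsto\<close> and \<open>module_bounded_image2_iff_tendsto\<close> state these
  translations; after them, the calculus of limits replaces the choice of neighborhoods.

  The sum converges because addition in \<open>X\<close> is continuous and because both given limits hold on
  the intersection of the two pairs of zero neighborhoods. For the product, split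
  \<open>r\<^sub>i \<sigma>\<^sub>i - r \<sigma> = r\<^sub>i (\<sigma>\<^sub>i - \<sigma>) + (r\<^sub>i - r) \<sigma>\<close>.
  The first summand tends to zero uniformly because \<open>\<sigma>\<^sub>i - \<sigma>\<close> does and scalar multiplication is
  jointly continuous at \<open>(r, 0)\<close>. The second one tends to zero uniformly on any pair of
  neighborhoods whose image under \<open>\<sigma>\<close> is bounded, since scalars tending to zero shrink a bounded
  set uniformly; the \<open>n\<close>-boundedness of \<open>\<sigma>\<close> provides such a pair.
\<close>

text \<open>
  The principal factor turns "eventually" into "eventually, for all points of \<open>S\<close> at once"; this is
  how a product filter encodes uniformity.
\<close>

lemma eventually_prod_principal:
  "eventually P (F \<times>\<^sub>F principal S) \<longleftrightarrow> eventually (\<lambda>i. \<forall>p\<in>S. P (i, p)) F"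
proof
  assume "eventually P (F \<times>\<^sub>F principal S)"
  then obtain A B where "eventually A F" "\<forall>p\<in>S. B p" "\<And>i p. A i \<Longrightarrow> B p \<Longrightarrow> P (i, p)"
    by (auto simp: eventually_prod_filter eventually_principal)
  then show "eventually (\<lambda>i. \<forall>p\<in>S. P (i, p)) F"
    by (auto elim: eventually_mono)
next
  assume "eventually (\<lambda>i. \<forall>p\<in>S. P (i, p)) F"
  then show "eventually P (F \<times>\<^sub>F principal S)"
    unfolding eventually_prod_filter
    by (intro exI[of _ "\<lambda>i. \<forall>p\<in>S. P (i, p)"] exI[of _ "\<lambda>p. p \<in> S"])
       (auto simp: eventually_principal)
qed

lemma tendsto_zero_iff_zero_nbhd:
  "(f \<longlongrightarrow> 0) F \<longleftrightarrow> (\<forall>W. zero_nbhd W \<longrightarrow> eventually (\<lambda>p. f p \<in> W) F)"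
proof
  assume "(f \<longlongrightarrow> 0) F"
  then show "\<forall>W. zero_nbhd W \<longrightarrow> eventually (\<lambda>p. f p \<in> W) F"
    unfolding zero_nbhd_iff filterlim_iff by blast
next
  assume *: "\<forall>W. zero_nbhd W \<longrightarrow> eventually (\<lambda>p. f p \<in> W) F"
  show "(f \<longlongrightarrow> 0) F"
  proof (rule topological_tendstoI)
    fix S :: "'b set" assume "open S" "0 \<in> S"
    then have "zero_nbhd S" unfolding zero_nbhd_def by blast
    with * show "eventually (\<lambda>p. f p \<in> S) F" by blast
  qed
qed

lemma (in directed_index) converges_to_zero_unif_iff_tendsto:
  "converges_to_zero_unif I le \<sigma>s \<longleftrightarrow>
     (\<exists>U V. zero_nbhd U \<and> zero_nbhd V \<and>
        ((\<lambda>(i, x, y). \<sigma>s i x y) \<longlongrightarrow> 0) (net_filter I le \<times>\<^sub>F principal (U \<times> V)))"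
proof -
  have "image2 (\<sigma>s b) U V \<subseteq> W \<longleftrightarrow> (\<forall>(x, y)\<in>U \<times> V. \<sigma>s b x y \<in> W)" for b U V W
    by (auto simp: image2_def)
  then show ?thesis
    unfolding converges_to_zero_unif_def
    by (simp add: tendsto_zero_iff_zero_nbhd eventually_prod_principal eventually_net_filter
        split_beta)
qed

text \<open>
  The set of scalars \<open>s\<close> with \<open>s \<sigma>(U, V) \<subseteq> W\<close> is the largest candidate for the neighborhood
  demanded by boundedness, so its being a zero neighborhood is the only condition.
\<close>

lemma module_bounded_image2_iff_tendsto:
  "module_bounded scale (image2 \<sigma> U V) \<longleftrightarrow>
     ((\<lambda>(s, x, y). scale s (\<sigma> x y)) \<longlongrightarrow> 0) (nhds 0 \<times>\<^sub>F principal (U \<times> V))"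
proof -
  have "(\<exists>N. zero_nbhd N \<and> image2 scale N (image2 \<sigma> U V) \<subseteq> W) \<longleftrightarrow>
      eventually (\<lambda>s. \<forall>(x, y)\<in>U \<times> V. scale s (\<sigma> x y) \<in> W) (nhds 0)"
    (is "?L \<longleftrightarrow> eventually ?P _") for W
  proof
    assume ?L
    then obtain N where N: "eventually (\<lambda>s. s \<in> N) (nhds 0)"
      "image2 scale N (image2 \<sigma> U V) \<subseteq> W"
      unfolding zero_nbhd_iff by blast
    from N(1) show "eventually ?P (nhds 0)"
      by (rule eventually_mono) (use N(2) in \<open>auto simp: image2_image2_subset_iff\<close>)
  next
    assume "eventually ?P (nhds 0)"
    then have "zero_nbhd (Collect ?P)" by (simp add: zero_nbhd_iff)
    moreover have "image2 scale (Collect ?P) (image2 \<sigma> U V) \<subseteq> W"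
      by (auto simp: image2_image2_subset_iff)
    ultimately show ?L by blast
  qed
  then show ?thesis
    unfolding module_bounded_def
    by (simp add: tendsto_zero_iff_zero_nbhd eventually_prod_principal split_beta)
qed

text \<open>
  Two uniform limits can be combined only on a common set; this shrinks each of them to the
  intersection.
\<close>

lemma tendsto_principal_subset:
  assumes "(f \<longlongrightarrow> l) (F \<times>\<^sub>F principal S)" and "T \<subseteq> S"
  shows "(f \<longlongrightarrow> l) (F \<times>\<^sub>F principal T)"
  by (rule tendsto_mono[OF prod_filter_mono assms(1)]) (use \<open>T \<subseteq> S\<close> in simp_all)

context topological_module
begin

lemma scale_zero_right: "scale r 0 = 0"
  using scale_right_distrib[of r 0 0] by simp

lemma scale_diff_right: "scale r (x - y) = scale r x - scale r y"
  using scale_right_distrib[of r "x - y" y] by (simp add: algebra_simps)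

lemma scale_diff_left: "scale (r - s) x = scale r x - scale s x"
  using scale_left_distrib[of "r - s" s x] by (simp add: algebra_simps)

text \<open>
  Continuity is used in its compositional form on the whole space, since the point-based rules for
  \<^const>\<open>isCont\<close> require a Hausdorff space.
\<close>

lemma tendsto_scale:
  assumes "(f \<longlongrightarrow> r) F" and "(g \<longlongrightarrow> x) F"
  shows "((\<lambda>p. scale (f p) (g p)) \<longlongrightarrow> scale r x) F"
proof -
  from continuous_on_tendsto_compose[OF continuous_scale tendsto_Pair[OF assms]] show ?thesis
    by simp
qed

end

context directed_index
begin

lemma converges_unif_add:
  assumes "converges_unif I le \<sigma>s \<sigma>" and "converges_unif I le \<gamma>s \<gamma>"
  shows "converges_unif I le (\<lambda>i x y. \<sigma>s i x y + \<gamma>s i x y) (\<lambda>x y. \<sigma> x y + \<gamma> x y)"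
proof -
  obtain U V where UV: "zero_nbhd U" "zero_nbhd V"
    "((\<lambda>(i, x, y). \<sigma>s i x y - \<sigma> x y) \<longlongrightarrow> 0) (net_filter I le \<times>\<^sub>F principal (U \<times> V))"
    using assms(1) by (auto simp: converges_unif_def converges_to_zero_unif_iff_tendsto)
  obtain U' V' where UV': "zero_nbhd U'" "zero_nbhd V'"
    "((\<lambda>(i, x, y). \<gamma>s i x y - \<gamma> x y) \<longlongrightarrow> 0) (net_filter I le \<times>\<^sub>F principal (U' \<times> V'))"
    using assms(2) by (auto simp: converges_unif_def converges_to_zero_unif_iff_tendsto)
  let ?F = "net_filter I le \<times>\<^sub>F principal ((U \<inter> U') \<times> (V \<inter> V'))"
  have "((\<lambda>(i, x, y). \<sigma>s i x y - \<sigma> x y) \<longlongrightarrow> 0) ?F" "((\<lambda>(i, x, y). \<gamma>s i x y - \<gamma> x y) \<longlongrightarrow> 0) ?F"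
    by (rule tendsto_principal_subset[OF UV(3)] tendsto_principal_subset[OF UV'(3)]; blast)+
  from tendsto_add[OF this]
  have "((\<lambda>(i, x, y). \<sigma>s i x y + \<gamma>s i x y - (\<sigma> x y + \<gamma> x y)) \<longlongrightarrow> 0) ?F"
    by (simp add: case_prod_unfold algebra_simps)
  then show ?thesis
    unfolding converges_unif_def converges_to_zero_unif_iff_tendsto
    using zero_nbhd_Int[OF UV(1) UV'(1)] zero_nbhd_Int[OF UV(2) UV'(2)] by blast
qed

lemma converges_unif_scale:
  assumes "topological_module scale" and "n_bounded scale \<sigma>"
    and "converges_unif I le \<sigma>s \<sigma>" and "(rs \<longlongrightarrow> r) (net_filter I le)"
  shows "converges_unif I le (\<lambda>i x y. scale (rs i) (\<sigma>s i x y)) (\<lambda>x y. scale r (\<sigma> x y))"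
proof -
  interpret topological_module scale by fact
  obtain U V where UV: "zero_nbhd U" "zero_nbhd V"
    "((\<lambda>(i, x, y). \<sigma>s i x y - \<sigma> x y) \<longlongrightarrow> 0) (net_filter I le \<times>\<^sub>F principal (U \<times> V))"
    using assms(3) by (auto simp: converges_unif_def converges_to_zero_unif_iff_tendsto)
  obtain U' V' where UV': "zero_nbhd U'" "zero_nbhd V'"
    "((\<lambda>(s, x, y). scale s (\<sigma> x y)) \<longlongrightarrow> 0) (nhds 0 \<times>\<^sub>F principal (U' \<times> V'))"
    using assms(2) by (auto simp: n_bounded_def module_bounded_image2_iff_tendsto)
  let ?S = "(U \<inter> U') \<times> (V \<inter> V')"
  let ?F = "net_filter I le \<times>\<^sub>F principal ?S"
  have fst: "filterlim fst (net_filter I le) ?F"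
    by (simp add: filterlim_def filtermap_fst_prod_filter)
  have "((\<lambda>(i, x, y). \<sigma>s i x y - \<sigma> x y) \<longlongrightarrow> 0) ?F"
    by (rule tendsto_principal_subset[OF UV(3)]) blast
  from tendsto_scale[OF filterlim_compose[OF assms(4) fst] this]
  have "((\<lambda>(i, x, y). scale (rs i) (\<sigma>s i x y - \<sigma> x y)) \<longlongrightarrow> 0) ?F"
    by (simp add: case_prod_unfold scale_zero_right)
  moreover
  have "((\<lambda>i. rs i - r) \<longlongrightarrow> 0) (net_filter I le)"
    using tendsto_diff[OF assms(4) tendsto_const[of r]] by simp
  \<comment> \<open>The boundedness limit for \<open>s \<rightarrow> 0\<close> is composed with \<open>s = r\<^sub>i - r\<close>, keeping \<open>(x, y)\<close> fixed.\<close>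
  from filterlim_compose[OF this fst]
  have "filterlim (\<lambda>p. (rs (fst p) - r, snd p)) (nhds 0 \<times>\<^sub>F principal ?S) ?F"
    by (rule filterlim_Pair) (simp add: filterlim_def filtermap_snd_prod_filter)
  from filterlim_compose[OF tendsto_principal_subset[OF UV'(3)] this]
  have "((\<lambda>(i, x, y). scale (rs i - r) (\<sigma> x y)) \<longlongrightarrow> 0) ?F"
    by (simp add: case_prod_unfold) blast
  ultimately
  have "((\<lambda>p. (case p of (i, x, y) \<Rightarrow> scale (rs i) (\<sigma>s i x y - \<sigma> x y)) +
      (case p of (i, x, y) \<Rightarrow> scale (rs i - r) (\<sigma> x y))) \<longlongrightarrow> 0 + 0) ?F"
    by (rule tendsto_add)
  then have "((\<lambda>(i, x, y). scale (rs i) (\<sigma>s i x y) - scale r (\<sigma> x y)) \<longlongrightarrow> 0) ?F"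
    by (simp add: case_prod_unfold scale_diff_right scale_diff_left)
  then show ?thesis
    unfolding converges_unif_def converges_to_zero_unif_iff_tendsto
    using zero_nbhd_Int[OF UV(1) UV'(1)] zero_nbhd_Int[OF UV(2) UV'(2)] by blast
qed

end

theorem theorem6:
  fixes scale :: "'r::{ring, topological_ab_group_add, topological_semigroup_mult}
      \<Rightarrow> 'x::topological_ab_group_add \<Rightarrow> 'x"
    and I :: "'i set" and le :: "'i \<Rightarrow> 'i \<Rightarrow> bool"
    and \<sigma>s \<gamma>s :: "'i \<Rightarrow> 'x \<Rightarrow> 'x \<Rightarrow> 'x" and \<sigma> \<gamma> :: "'x \<Rightarrow> 'x \<Rightarrow> 'x"
    and rs :: "'i \<Rightarrow> 'r" and r :: 'r
  assumes "topological_module scale"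
    and "directed_index I le"
    and "\<And>i. i \<in> I \<Longrightarrow> \<sigma>s i \<in> Bn scale"
    and "\<And>i. i \<in> I \<Longrightarrow> \<gamma>s i \<in> Bn scale"
    and "\<sigma> \<in> Bn scale"
    and "\<gamma> \<in> Bn scale"
    and "converges_unif I le \<sigma>s \<sigma>"
    and "converges_unif I le \<gamma>s \<gamma>"
    and "(rs \<longlongrightarrow> r) (net_filter I le)"
  shows "converges_unif I le (\<lambda>i x y. \<sigma>s i x y + \<gamma>s i x y) (\<lambda>x y. \<sigma> x y + \<gamma> x y) \<and>
    converges_unif I le (\<lambda>i x y. scale (rs i) (\<sigma>s i x y)) (\<lambda>x y. scale r (\<sigma> x y))"
  using directed_index.converges_unif_add[OF assms(2,7,8)]
    directed_index.converges_unif_scale[OF assms(2,1) _ assms(7,9)] assms(5)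
  by (simp add: Bn_def)

end
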